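(* Let $X$ be a Tychonoff space and let $\mathscr{P}$ be an ideal of closed sets in $X$ with $|X_\mathscr{P}|\geq 3$. If $X_\mathscr{P}$ does not contain any isolated point of $X$, then $AG(C_\mathscr{P}(X))$ is hypertriangulated.
   Context: $C(X)$ is the ring of all real valued continuous functions on the Tychonoff (completely regular Hausdorff) space $X$; $Z(f)=\{x\in X: f(x)=0\}$. An ideal of closed sets in $X$ is a nonempty family $\mathscr{P}$ of closed subsets of $X$ such that $A,B\in\mathscr{P}$ implies $A\cup B\in\mathscr{P}$, and $A\in\mathscr{P}$, $C\subset A$ with $C$ closed in $X$ implies $C\in\mathscr{P}$. $C_\mathscr{P}(X)=\{f\in C(X): cl_X(X\setminus Z(f))\in\mathscr{P}\}$, a commutative ring (possibly without identity). $X_\mathscr{P}$ is the set of all $x\in X$ having an open neighborhood $V$ with $cl_XV\in\mathscr{P}$. For a commutative ring $R$, $Z(R)^*$ is the set of nonzero zero divisors, i.e. nonzero $a\in R$ with $ab=0$ for some nonzero $b\in R$, and $ann(a)=\{r\in R: ra=0\}$. The annihilator graph $AG(R)$ is the simple graph with vertex set $Z(R)^*$ in which distinct $a,b$ are adjacent iff $ann(a)\cup ann(b)\neq ann(ab)$. A graph is hypertriangulated if each of its edges is an edge of a triangle. *)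

theory Defs
  imports "HOL-Analysis.Analysis" "HOL-Algebra.Ideal"
begin

definition tychonoff_space :: "'a topology \<Rightarrow> bool" where
  "tychonoff_space X \<longleftrightarrow> completely_regular_space X \<and> Hausdorff_space X"

definition ideal_of_closed_sets :: "'a topology \<Rightarrow> 'a set set \<Rightarrow> bool" where
  "ideal_of_closed_sets X P \<longleftrightarrow>
     P \<noteq> {} \<and> (\<forall>A\<in>P. closedin X A) \<and>
     (\<forall>A\<in>P. \<forall>B\<in>P. A \<union> B \<in> P) \<and>
     (\<forall>A\<in>P. \<forall>C. C \<subseteq> A \<and> closedin X C \<longrightarrow> C \<in> P)"

text \<open>A function on \<open>X\<close> is represented by a function on the ambient type that is \<open>undefined\<close>
  outside \<open>topspace X\<close>, so that equality of functions is equality on \<open>topspace X\<close>.\<close>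

definition cont_ring :: "'a topology \<Rightarrow> ('a \<Rightarrow> real) ring" where
  "cont_ring X =
     \<lparr>carrier = {f \<in> extensional (topspace X). continuous_map X euclideanreal f},
      mult = (\<lambda>f g. \<lambda>x\<in>topspace X. f x * g x),
      one = (\<lambda>x\<in>topspace X. 1),
      zero = (\<lambda>x\<in>topspace X. 0),
      add = (\<lambda>f g. \<lambda>x\<in>topspace X. f x + g x)\<rparr>"

definition zero_set :: "'a topology \<Rightarrow> ('a \<Rightarrow> real) \<Rightarrow> 'a set" where
  "zero_set X f = {x \<in> topspace X. f x = 0}"

text \<open>The ring below need not have an identity. Its field \<open>one\<close>, inherited from \<open>cont_ring X\<close>, may
  lie outside the carrier and has no meaning; no definition below refers to it.\<close>

definition cont_ring_ideal :: "'a topology \<Rightarrow> 'a set set \<Rightarrow> ('a \<Rightarrow> real) ring" where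
  "cont_ring_ideal X P =
     cont_ring X \<lparr>carrier := {f \<in> carrier (cont_ring X).
       X closure_of (topspace X - zero_set X f) \<in> P}\<rparr>"

definition ideal_points :: "'a topology \<Rightarrow> 'a set set \<Rightarrow> 'a set" where
  "ideal_points X P = {x \<in> topspace X. \<exists>V. openin X V \<and> x \<in> V \<and> X closure_of V \<in> P}"

definition nonzero_zero_divisors :: "('a, 'm) ring_scheme \<Rightarrow> 'a set" where
  "nonzero_zero_divisors R =
     {a \<in> carrier R. a \<noteq> \<zero>\<^bsub>R\<^esub> \<and> (\<exists>b\<in>carrier R. b \<noteq> \<zero>\<^bsub>R\<^esub> \<and> a \<otimes>\<^bsub>R\<^esub> b = \<zero>\<^bsub>R\<^esub>)}"

definition annihilator :: "('a, 'm) ring_scheme \<Rightarrow> 'a \<Rightarrow> 'a set" where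
  "annihilator R a = {r \<in> carrier R. r \<otimes>\<^bsub>R\<^esub> a = \<zero>\<^bsub>R\<^esub>}"

text \<open>A simple graph is a pair of its vertex set and its edge set, edges being two-element sets of
  vertices.\<close>

type_synonym 'v simple_graph = "'v set \<times> 'v set set"

definition annihilator_graph :: "('a, 'm) ring_scheme \<Rightarrow> 'a simple_graph" where
  "annihilator_graph R =
     (nonzero_zero_divisors R,
      {{a, b} | a b. a \<in> nonzero_zero_divisors R \<and> b \<in> nonzero_zero_divisors R \<and> a \<noteq> b \<and>
         annihilator R a \<union> annihilator R b \<noteq> annihilator R (a \<otimes>\<^bsub>R\<^esub> b)})"

definition is_triangle :: "'v simple_graph \<Rightarrow> 'v \<Rightarrow> 'v \<Rightarrow> 'v \<Rightarrow> bool" where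
  "is_triangle G a b c \<longleftrightarrow>
     a \<in> fst G \<and> b \<in> fst G \<and> c \<in> fst G \<and> a \<noteq> b \<and> b \<noteq> c \<and> a \<noteq> c \<and>
     {a, b} \<in> snd G \<and> {b, c} \<in> snd G \<and> {a, c} \<in> snd G"

definition hypertriangulated :: "'v simple_graph \<Rightarrow> bool" where
  "hypertriangulated G \<longleftrightarrow>
     (\<forall>e\<in>snd G. \<exists>a b c. is_triangle G a b c \<and> e \<in> {{a, b}, {b, c}, {a, c}})"

end

theory Submission
  imports Defs
begin

text \<open>Pointwise, \<open>a\<close> and \<open>b\<close> are adjacent exactly when some ring element \<open>r\<close> satisfies
  \<open>r a b = 0\<close>, \<open>r a \<noteq> 0\<close> and \<open>r b \<noteq> 0\<close>. Then the cozero sets \<open>U\<close> of \<open>r a\<close> and \<open>V\<close> of \<open>r b\<close> are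
  nonempty open sets with \<open>a\<close> nonzero on \<open>U\<close> and zero on \<open>V\<close>, and \<open>b\<close> nonzero on \<open>V\<close> and zero on
  \<open>U\<close>. Both lie in the set of ideal points, so neither contains an isolated point, and complete
  regularity provides nonzero ring elements \<open>f1\<close>, \<open>f2\<close> with disjoint cozero sets inside \<open>U\<close>, and \<open>g1\<close>,
  \<open>g2\<close> with disjoint cozero sets inside \<open>V\<close> (\<open>disjoint_bumps\<close>).

  The third vertex of the triangle is \<open>c = f1 + g1\<close>. It is a zero divisor since \<open>c f2 = 0\<close>. It is
  adjacent to \<open>a\<close>, because \<open>r = f2 + g1\<close> gives \<open>r a c = g1\<^sup>2 a = 0\<close>, \<open>r a = f2 a \<noteq> 0\<close> and
  \<open>r c = g1\<^sup>2 \<noteq> 0\<close>; exchanging the two sides, \<open>f1 + g2\<close> shows that it is adjacent to \<open>b\<close>.\<close>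

lemma carrier_cont_ring_ideal:
  "f \<in> carrier (cont_ring_ideal X P) \<longleftrightarrow>
     f \<in> extensional (topspace X) \<and> continuous_map X euclideanreal f \<and>
     X closure_of {x \<in> topspace X. f x \<noteq> 0} \<in> P"
proof -
  have "topspace X - zero_set X f = {x \<in> topspace X. f x \<noteq> 0}"
    by (auto simp: zero_set_def)
  then show ?thesis
    by (simp add: cont_ring_ideal_def cont_ring_def)
qed

lemma mult_cont_ring_ideal:
  "f \<otimes>\<^bsub>cont_ring_ideal X P\<^esub> g = (\<lambda>x\<in>topspace X. f x * g x)"
  by (simp add: cont_ring_ideal_def cont_ring_def)

lemma zero_cont_ring_ideal:
  "\<zero>\<^bsub>cont_ring_ideal X P\<^esub> = (\<lambda>x\<in>topspace X. 0)"
  by (simp add: cont_ring_ideal_def cont_ring_def)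

lemma add_cont_ring_ideal:
  "f \<oplus>\<^bsub>cont_ring_ideal X P\<^esub> g = (\<lambda>x\<in>topspace X. f x + g x)"
  by (simp add: cont_ring_ideal_def cont_ring_def)

lemma restrict_eq_zero_iff:
  "restrict h A = (\<lambda>x\<in>A. 0) \<longleftrightarrow> (\<forall>x\<in>A. h x = (0::real))"
  by (auto simp: restrict_def fun_eq_iff)

lemma eq_zero_cont_ring_ideal_iff:
  assumes "f \<in> carrier (cont_ring_ideal X P)"
  shows "f = \<zero>\<^bsub>cont_ring_ideal X P\<^esub> \<longleftrightarrow> (\<forall>x\<in>topspace X. f x = 0)"
  using assms
  by (auto simp: carrier_cont_ring_ideal zero_cont_ring_ideal extensional_def restrict_def fun_eq_iff)

lemma mult_eq_zero_cont_ring_ideal_iff: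
  "f \<otimes>\<^bsub>cont_ring_ideal X P\<^esub> g = \<zero>\<^bsub>cont_ring_ideal X P\<^esub> \<longleftrightarrow>
     (\<forall>x\<in>topspace X. f x * g x = 0)"
  by (simp only: mult_cont_ring_ideal zero_cont_ring_ideal restrict_eq_zero_iff)

lemma add_closed_cont_ring_ideal:
  assumes P: "ideal_of_closed_sets X P"
    and f: "f \<in> carrier (cont_ring_ideal X P)" and g: "g \<in> carrier (cont_ring_ideal X P)"
  shows "f \<oplus>\<^bsub>cont_ring_ideal X P\<^esub> g \<in> carrier (cont_ring_ideal X P)"
proof -
  let ?h = "\<lambda>x\<in>topspace X. f x + g x"
  have "{x \<in> topspace X. ?h x \<noteq> 0} \<subseteq> {x \<in> topspace X. f x \<noteq> 0} \<union> {x \<in> topspace X. g x \<noteq> 0}"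
    by auto
  then have "X closure_of {x \<in> topspace X. ?h x \<noteq> 0} \<subseteq>
      X closure_of {x \<in> topspace X. f x \<noteq> 0} \<union> X closure_of {x \<in> topspace X. g x \<noteq> 0}"
    unfolding closure_of_Un[symmetric] by (rule closure_of_mono)
  moreover have "X closure_of {x \<in> topspace X. f x \<noteq> 0} \<union>
      X closure_of {x \<in> topspace X. g x \<noteq> 0} \<in> P"
    using P f g unfolding ideal_of_closed_sets_def carrier_cont_ring_ideal by blast
  ultimately have "X closure_of {x \<in> topspace X. ?h x \<noteq> 0} \<in> P"
    using P unfolding ideal_of_closed_sets_def by (meson closedin_closure_of)
  moreover have "continuous_map X euclideanreal ?h"
  proof (rule continuous_map_eq)
    show "continuous_map X euclideanreal (\<lambda>x. f x + g x)"
      using f g by (simp add: carrier_cont_ring_ideal continuous_map_add)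
  qed auto
  ultimately show ?thesis
    unfolding carrier_cont_ring_ideal add_cont_ring_ideal by simp
qed

lemma nonzero_zero_divisors_cont_ring_ideal_iff:
  "a \<in> nonzero_zero_divisors (cont_ring_ideal X P) \<longleftrightarrow>
     a \<in> carrier (cont_ring_ideal X P) \<and> (\<exists>x\<in>topspace X. a x \<noteq> 0) \<and>
     (\<exists>d\<in>carrier (cont_ring_ideal X P).
        (\<exists>x\<in>topspace X. d x \<noteq> 0) \<and> (\<forall>x\<in>topspace X. a x * d x = 0))"
  unfolding nonzero_zero_divisors_def mult_eq_zero_cont_ring_ideal_iff
  using eq_zero_cont_ring_ideal_iff by blast

text \<open>Always \<open>ann(a) \<union> ann(b) \<subseteq> ann(ab)\<close>, so an edge amounts to an element of \<open>ann(ab)\<close> outside both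
  annihilators. Such an element also forces \<open>a \<noteq> b\<close>, as \<open>r a\<^sup>2 = 0\<close> implies \<open>r a = 0\<close> for
  real-valued functions.\<close>

lemma edge_annihilator_graph_iff:
  "{a, b} \<in> snd (annihilator_graph (cont_ring_ideal X P)) \<longleftrightarrow>
     a \<in> nonzero_zero_divisors (cont_ring_ideal X P) \<and>
     b \<in> nonzero_zero_divisors (cont_ring_ideal X P) \<and>
     (\<exists>r\<in>carrier (cont_ring_ideal X P).
        (\<forall>x\<in>topspace X. r x * (a x * b x) = 0) \<and>
        (\<exists>x\<in>topspace X. r x * a x \<noteq> 0) \<and> (\<exists>x\<in>topspace X. r x * b x \<noteq> 0))"
    (is "?E \<longleftrightarrow> ?a \<and> ?b \<and> (\<exists>r\<in>?C. ?W r)")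
proof -
  let ?R = "cont_ring_ideal X P"
  have ann: "r \<in> annihilator ?R f \<longleftrightarrow> r \<in> ?C \<and> (\<forall>x\<in>topspace X. r x * f x = 0)" for r f
    by (simp add: annihilator_def mult_eq_zero_cont_ring_ideal_iff)
  have ann_mult: "r \<in> annihilator ?R (f \<otimes>\<^bsub>?R\<^esub> g) \<longleftrightarrow>
      r \<in> ?C \<and> (\<forall>x\<in>topspace X. r x * (f x * g x) = 0)" for r f g
    by (simp add: ann mult_cont_ring_ideal)
  have "annihilator ?R f \<union> annihilator ?R g \<subseteq> annihilator ?R (f \<otimes>\<^bsub>?R\<^esub> g)" for f g
    by (auto simp: ann mult_cont_ring_ideal)
  then have "annihilator ?R f \<union> annihilator ?R g \<noteq> annihilator ?R (f \<otimes>\<^bsub>?R\<^esub> g) \<longleftrightarrow>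
      (\<exists>r. r \<in> annihilator ?R (f \<otimes>\<^bsub>?R\<^esub> g) \<and> r \<notin> annihilator ?R f \<and> r \<notin> annihilator ?R g)" for f g
    by blast
  then have ne: "annihilator ?R f \<union> annihilator ?R g \<noteq> annihilator ?R (f \<otimes>\<^bsub>?R\<^esub> g) \<longleftrightarrow>
      (\<exists>r\<in>?C. (\<forall>x\<in>topspace X. r x * (f x * g x) = 0) \<and>
        (\<exists>x\<in>topspace X. r x * f x \<noteq> 0) \<and> (\<exists>x\<in>topspace X. r x * g x \<noteq> 0))" for f g
    unfolding ann_mult unfolding ann by blast
  have "\<exists>r\<in>?C. ?W r \<Longrightarrow> a \<noteq> b"
    by auto
  moreover have "?E \<longleftrightarrow> ?a \<and> ?b \<and> a \<noteq> b \<and>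
      annihilator ?R a \<union> annihilator ?R b \<noteq> annihilator ?R (a \<otimes>\<^bsub>?R\<^esub> b)"
  proof -
    have "annihilator ?R b \<union> annihilator ?R a \<noteq> annihilator ?R (b \<otimes>\<^bsub>?R\<^esub> a) \<longleftrightarrow>
        annihilator ?R a \<union> annihilator ?R b \<noteq> annihilator ?R (a \<otimes>\<^bsub>?R\<^esub> b)"
      by (simp add: mult_cont_ring_ideal mult.commute Un_commute)
    then show ?thesis
      unfolding annihilator_graph_def snd_conv mem_Collect_eq doubleton_eq_iff by metis
  qed
  ultimately show ?thesis
    unfolding ne by blast
qed

lemma cozero_subset_ideal_points:
  assumes "f \<in> carrier (cont_ring_ideal X P)"
  shows "{x \<in> topspace X. f x \<noteq> 0} \<subseteq> ideal_points X P"
proof -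
  have "openin X {x \<in> topspace X. f x \<in> - {0}}"
    using assms
    by (intro openin_continuous_map_preimage[of X euclideanreal])
       (auto simp: carrier_cont_ring_ideal)
  then show ?thesis
    using assms unfolding carrier_cont_ring_ideal ideal_points_def by auto
qed

text \<open>The bump function separating a point from the complement of a neighbourhood whose closure is
  in \<open>P\<close> belongs to the ring.\<close>

lemma bump_at_ideal_point:
  assumes "completely_regular_space X" and P: "ideal_of_closed_sets X P"
    and U: "openin X U" "x \<in> U" and x: "x \<in> ideal_points X P"
  obtains f where "f \<in> carrier (cont_ring_ideal X P)" "f x \<noteq> 0"
    "\<And>y. y \<in> topspace X \<Longrightarrow> f y \<noteq> 0 \<Longrightarrow> y \<in> U"
proof -
  obtain V where V: "openin X V" "x \<in> V" "X closure_of V \<in> P"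
    using x by (auto simp: ideal_points_def)
  have "closedin X (topspace X - U \<inter> V)" "x \<in> topspace X - (topspace X - U \<inter> V)"
    using U V openin_subset by (blast intro: openin_Int)+
  then obtain h where h: "continuous_map X (top_of_set {0..1::real}) h" "h x = 0"
    "h ` (topspace X - U \<inter> V) \<subseteq> {1}"
    using assms(1) unfolding completely_regular_space_def by metis
  define f where "f = (\<lambda>y\<in>topspace X. 1 - h y)"
  have supp: "{y \<in> topspace X. f y \<noteq> 0} \<subseteq> U \<inter> V"
    using h(3) by (auto simp: f_def)
  have "continuous_map X euclideanreal f"
  proof (rule continuous_map_eq)
    show "continuous_map X euclideanreal (\<lambda>y. 1 - h y)"
      using h(1) by (intro continuous_map_diff) (auto simp: continuous_map_in_subtopology)
  qed (auto simp: f_def)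
  moreover have "X closure_of {y \<in> topspace X. f y \<noteq> 0} \<in> P"
  proof -
    have "X closure_of {y \<in> topspace X. f y \<noteq> 0} \<subseteq> X closure_of V"
      using supp by (intro closure_of_mono) auto
    then show ?thesis
      using P V(3) unfolding ideal_of_closed_sets_def by (meson closedin_closure_of)
  qed
  ultimately have "f \<in> carrier (cont_ring_ideal X P)"
    by (simp add: carrier_cont_ring_ideal f_def)
  moreover have "f x \<noteq> 0"
    using x h(2) by (simp add: f_def ideal_points_def)
  ultimately show ?thesis
    using supp that by auto
qed

text \<open>A nonempty open set without isolated points has at least two points; bumps at these two points
  inside disjoint neighbourhoods are the required functions.\<close>

lemma disjoint_bumps:
  assumes X: "tychonoff_space X" and P: "ideal_of_closed_sets X P"
    and no_isolated: "\<And>x. x \<in> ideal_points X P \<Longrightarrow> \<not> openin X {x}"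
    and U: "openin X U" "U \<subseteq> ideal_points X P" "U \<noteq> {}"
  obtains f g where
    "f \<in> carrier (cont_ring_ideal X P)" "\<exists>x\<in>topspace X. f x \<noteq> 0"
    "g \<in> carrier (cont_ring_ideal X P)" "\<exists>x\<in>topspace X. g x \<noteq> 0"
    "\<forall>y\<in>topspace X. f y = 0 \<or> g y = 0"
    "\<forall>y\<in>topspace X - U. f y = 0 \<and> g y = 0"
proof -
  obtain x where x: "x \<in> U"
    using U(3) by blast
  have "U \<noteq> {x}"
    using no_isolated U x by blast
  then obtain y where y: "y \<in> U" "y \<noteq> x"
    using x by blast
  have xy: "x \<in> topspace X" "y \<in> topspace X" "x \<in> ideal_points X P" "y \<in> ideal_points X P"
    using x y U openin_subset by blast+
  have cr: "completely_regular_space X" and "Hausdorff_space X"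
    using X by (auto simp: tychonoff_space_def)
  then obtain V W where VW: "openin X V" "openin X W" "x \<in> V" "y \<in> W" "disjnt V W"
    using xy y(2) unfolding Hausdorff_space_def by metis
  have nhds: "openin X (U \<inter> V)" "x \<in> U \<inter> V" "openin X (U \<inter> W)" "y \<in> U \<inter> W"
    using x y U VW by auto
  obtain f where f: "f \<in> carrier (cont_ring_ideal X P)" "f x \<noteq> 0"
    "\<And>z. z \<in> topspace X \<Longrightarrow> f z \<noteq> 0 \<Longrightarrow> z \<in> U \<inter> V"
    using bump_at_ideal_point[OF cr P nhds(1,2) xy(3)] by metis
  obtain g where g: "g \<in> carrier (cont_ring_ideal X P)" "g y \<noteq> 0"
    "\<And>z. z \<in> topspace X \<Longrightarrow> g z \<noteq> 0 \<Longrightarrow> z \<in> U \<inter> W"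
    using bump_at_ideal_point[OF cr P nhds(3,4) xy(4)] by metis
  show ?thesis
  proof (rule that[of f g])
    show "\<forall>z\<in>topspace X. f z = 0 \<or> g z = 0"
      using f(3) g(3) VW(5) unfolding disjnt_iff by blast
  qed (use f g xy in blast)+
qed

lemma openin_cozero_mult:
  assumes "r \<in> carrier (cont_ring_ideal X P)" "a \<in> carrier (cont_ring_ideal X P)"
  shows "openin X {x \<in> topspace X. r x * a x \<noteq> 0}"
proof -
  have "openin X {x \<in> topspace X. r x * a x \<in> - {0}}"
    using assms
    by (intro openin_continuous_map_preimage[of X euclideanreal] continuous_map_real_mult)
       (auto simp: carrier_cont_ring_ideal)
  then show ?thesis
    by simp
qed

text \<open>The edge is witnessed by \<open>r = f2 + g1\<close>: the product \<open>r c = (f2 + g1) (f1 + g1)\<close> reduces to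
  \<open>g1\<^sup>2\<close>, which lives where \<open>a\<close> vanishes. The edge from \<open>c\<close> to the other end \<open>b\<close> of the given edge
  is the same lemma with the functions \<open>f\<close> and \<open>g\<close> exchanged, as \<open>c = g1 + f1\<close>.\<close>

lemma edge_to_sum_of_bumps:
  assumes P: "ideal_of_closed_sets X P"
    and a: "a \<in> nonzero_zero_divisors (cont_ring_ideal X P)"
    and c: "c \<in> carrier (cont_ring_ideal X P)" "\<And>x. x \<in> topspace X \<Longrightarrow> c x = f1 x + g1 x"
    and f2: "f2 \<in> carrier (cont_ring_ideal X P)" "\<exists>x\<in>topspace X. f2 x \<noteq> 0"
    and g1: "g1 \<in> carrier (cont_ring_ideal X P)" "\<exists>x\<in>topspace X. g1 x \<noteq> 0"
    and disj: "\<And>x. x \<in> topspace X \<Longrightarrow> f1 x = 0 \<or> f2 x = 0"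
    and f_supp: "\<And>x. x \<in> topspace X \<Longrightarrow> a x = 0 \<Longrightarrow> f1 x = 0 \<and> f2 x = 0"
    and g_supp: "\<And>x. x \<in> topspace X \<Longrightarrow> a x \<noteq> 0 \<Longrightarrow> g1 x = 0"
  shows "{a, c} \<in> snd (annihilator_graph (cont_ring_ideal X P))"
proof -
  let ?R = "cont_ring_ideal X P"
  let ?r = "f2 \<oplus>\<^bsub>?R\<^esub> g1"
  have r: "?r x = f2 x + g1 x" if "x \<in> topspace X" for x
    using that by (simp add: add_cont_ring_ideal)
  have cases: "f2 x * g1 x = 0" "f1 x * g1 x = 0" if "x \<in> topspace X" for x
    using f_supp[OF that] g_supp[OF that] by auto
  have c_nonzero: "\<exists>x\<in>topspace X. c x \<noteq> 0"
    using g1(2) c(2) cases(2) by (metis add_0 mult_eq_0_iff)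
  have c_f2: "\<forall>x\<in>topspace X. c x * f2 x = 0"
  proof
    fix x assume x: "x \<in> topspace X"
    show "c x * f2 x = 0"
      using disj[OF x] cases(1)[OF x] by (auto simp: c(2)[OF x])
  qed
  have "c \<in> nonzero_zero_divisors ?R"
    unfolding nonzero_zero_divisors_cont_ring_ideal_iff using c(1) c_nonzero f2 c_f2 by blast
  moreover have "?r \<in> carrier ?R"
    using add_closed_cont_ring_ideal[OF P f2(1) g1(1)] .
  moreover have "\<forall>x\<in>topspace X. ?r x * (a x * c x) = 0"
  proof
    fix x assume x: "x \<in> topspace X"
    show "?r x * (a x * c x) = 0"
      using disj[OF x] g_supp[OF x] by (cases "a x = 0") (auto simp: r[OF x] c(2)[OF x])
  qed
  moreover have "\<exists>x\<in>topspace X. ?r x * a x \<noteq> 0"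
  proof -
    obtain x where x: "x \<in> topspace X" "f2 x \<noteq> 0"
      using f2(2) by blast
    then have "a x \<noteq> 0" "g1 x = 0"
      using f_supp g_supp by blast+
    then show ?thesis
      using x r[OF x(1)] by force
  qed
  moreover have "\<exists>x\<in>topspace X. ?r x * c x \<noteq> 0"
  proof -
    obtain x where x: "x \<in> topspace X" "g1 x \<noteq> 0"
      using g1(2) by blast
    then have "f1 x = 0" "f2 x = 0"
      using cases by (metis mult_eq_0_iff)+
    then show ?thesis
      using x r[OF x(1)] c(2)[OF x(1)] by force
  qed
  ultimately show ?thesis
    unfolding edge_annihilator_graph_iff using a by blast
qed

theorem theorem3p10:
  fixes X :: "'a topology" and P :: "'a set set"
  assumes "tychonoff_space X"
    and "ideal_of_closed_sets X P"
    and "finite (ideal_points X P) \<longrightarrow> card (ideal_points X P) \<ge> 3"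
    and "\<forall>x\<in>ideal_points X P. \<not> openin X {x}"
  shows "hypertriangulated (annihilator_graph (cont_ring_ideal X P))"
  unfolding hypertriangulated_def
proof
  let ?R = "cont_ring_ideal X P"
  let ?G = "annihilator_graph ?R"
  note P = assms(2)
  fix e assume e: "e \<in> snd ?G"
  then obtain a b where ab: "e = {a, b}"
    unfolding annihilator_graph_def by auto
  then have vertices: "a \<in> nonzero_zero_divisors ?R" "b \<in> nonzero_zero_divisors ?R"
    using e by (auto simp: edge_annihilator_graph_iff)
  then have carr: "a \<in> carrier ?R" "b \<in> carrier ?R"
    by (auto simp: nonzero_zero_divisors_def)
  obtain r where r: "r \<in> carrier ?R" "\<And>x. x \<in> topspace X \<Longrightarrow> r x * (a x * b x) = 0"
    "\<exists>x\<in>topspace X. r x * a x \<noteq> 0" "\<exists>x\<in>topspace X. r x * b x \<noteq> 0"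
    using e unfolding ab edge_annihilator_graph_iff by blast
  define U where "U = {x \<in> topspace X. r x * a x \<noteq> 0}"
  define V where "V = {x \<in> topspace X. r x * b x \<noteq> 0}"
  have U: "openin X U" "U \<subseteq> ideal_points X P" "U \<noteq> {}"
    using openin_cozero_mult[OF r(1) carr(1)] cozero_subset_ideal_points[OF carr(1)] r(3)
    by (auto simp: U_def)
  have V: "openin X V" "V \<subseteq> ideal_points X P" "V \<noteq> {}"
    using openin_cozero_mult[OF r(1) carr(2)] cozero_subset_ideal_points[OF carr(2)] r(4)
    by (auto simp: V_def)
  have on_U: "a x \<noteq> 0 \<and> b x = 0" if "x \<in> U" for x
    using that r(2)[of x] by (auto simp: U_def)
  have on_V: "b x \<noteq> 0 \<and> a x = 0" if "x \<in> V" for x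
    using that r(2)[of x] by (auto simp: V_def)
  have no_isolated: "\<And>x. x \<in> ideal_points X P \<Longrightarrow> \<not> openin X {x}"
    using assms(4) by blast
  obtain f1 f2 where f:
    "f1 \<in> carrier ?R" "\<exists>x\<in>topspace X. f1 x \<noteq> 0" "f2 \<in> carrier ?R" "\<exists>x\<in>topspace X. f2 x \<noteq> 0"
    "\<forall>x\<in>topspace X. f1 x = 0 \<or> f2 x = 0"
    "\<forall>x\<in>topspace X - U. f1 x = 0 \<and> f2 x = 0"
    using disjoint_bumps[OF assms(1) P no_isolated U] by blast
  obtain g1 g2 where g:
    "g1 \<in> carrier ?R" "\<exists>x\<in>topspace X. g1 x \<noteq> 0" "g2 \<in> carrier ?R" "\<exists>x\<in>topspace X. g2 x \<noteq> 0"
    "\<forall>x\<in>topspace X. g1 x = 0 \<or> g2 x = 0"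
    "\<forall>x\<in>topspace X - V. g1 x = 0 \<and> g2 x = 0"
    using disjoint_bumps[OF assms(1) P no_isolated V] by blast
  define c where "c = f1 \<oplus>\<^bsub>?R\<^esub> g1"
  have c: "c x = f1 x + g1 x" "c x = g1 x + f1 x" if "x \<in> topspace X" for x
    using that by (auto simp: c_def add_cont_ring_ideal)
  have c_carr: "c \<in> carrier ?R"
    unfolding c_def by (rule add_closed_cont_ring_ideal[OF P f(1) g(1)])
  have ac: "{a, c} \<in> snd ?G"
    by (rule edge_to_sum_of_bumps[OF P vertices(1) c_carr c(1) f(3,4) g(1,2) f(5)[rule_format]])
       (use f(6) g(6) on_U on_V in blast)+
  have bc: "{b, c} \<in> snd ?G"
    by (rule edge_to_sum_of_bumps[OF P vertices(2) c_carr c(2) g(3,4) f(1,2) g(5)[rule_format]])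
       (use f(6) g(6) on_U on_V in blast)+
  have distinct: "p \<noteq> q" if "{p, q} \<in> snd ?G" for p q
    using that unfolding edge_annihilator_graph_iff by auto
  have fst_G: "fst ?G = nonzero_zero_divisors ?R"
    by (simp add: annihilator_graph_def)
  have c_vertex: "c \<in> nonzero_zero_divisors ?R"
    using ac unfolding edge_annihilator_graph_iff by blast
  have "is_triangle ?G a b c"
    unfolding is_triangle_def using vertices c_vertex e ab ac bc distinct fst_G by blast
  then show "\<exists>a b c. is_triangle ?G a b c \<and> e \<in> {{a, b}, {b, c}, {a, c}}"
    using ab by blast
qed

end
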